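(* For all $\varepsilon \in [0,1)$, $\delta_f(\varepsilon) \leq \frac{3+\sqrt{57}}{12} < 0.88$.
   Context: For a $3$-uniform hypergraph $H$, its $2$-shadow $H^{(2)}$ is the graph on $V(H)$ whose edges are the pairs $\{u,v\}$ contained in some edge of $H$. A perfect fractional STS of $H$ is a function $\phi: E(H) \to [0,1]$ such that $\sum_{f \in E(H),\, e \subset f} \phi(f) = 1$ for every $e \in E(H^{(2)})$. For $\varepsilon \in [0,1)$, $\delta_f(\varepsilon)$ is the infimum of the set of $\delta \in [0,1]$ with the following property: there is $n_0$ such that every $3$-uniform hypergraph $H$ on $n \geq n_0$ vertices with minimum degree $\delta(H^{(2)}) \geq (1-\varepsilon)(n-1)$ and in which every $e \in E(H^{(2)})$ is contained in at least $\delta (n-2)$ edges of $H$ has a perfect fractional STS. *)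

theory Defs
  imports Complex_Main
begin

text \<open>A hypergraph is given by its vertex set and its edge set; isolated vertices are allowed.\<close>

definition three_uniform_hypergraph :: "'a set \<Rightarrow> 'a set set \<Rightarrow> bool" where
  "three_uniform_hypergraph V E \<longleftrightarrow> finite V \<and> (\<forall>f\<in>E. f \<subseteq> V \<and> card f = 3)"

definition two_shadow :: "'a set set \<Rightarrow> 'a set set" where
  "two_shadow E = {e. card e = 2 \<and> (\<exists>f\<in>E. e \<subseteq> f)}"

definition degree :: "'a set set \<Rightarrow> 'a \<Rightarrow> nat" where
  "degree G v = card {e \<in> G. v \<in> e}"

text \<open>Meaningful only for finite nonempty \<open>V\<close>.\<close>

definition min_degree :: "'a set \<Rightarrow> 'a set set \<Rightarrow> nat" where
  "min_degree V G = Min (degree G ` V)"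

definition codegree :: "'a set set \<Rightarrow> 'a set \<Rightarrow> nat" where
  "codegree E e = card {f \<in> E. e \<subseteq> f}"

definition perfect_fractional_STS :: "'a set set \<Rightarrow> ('a set \<Rightarrow> real) \<Rightarrow> bool" where
  "perfect_fractional_STS E \<phi> \<longleftrightarrow>
     (\<forall>f\<in>E. 0 \<le> \<phi> f \<and> \<phi> f \<le> 1) \<and>
     (\<forall>e\<in>two_shadow E. (\<Sum>f\<in>{f \<in> E. e \<subseteq> f}. \<phi> f) = 1)"

text \<open>
  Vertices are natural numbers, which loses nothing: every finite hypergraph is isomorphic to
  one on a finite set of naturals. The minimum degree of the empty vertex set is immaterial, as
  \<open>n\<^sub>0\<close> may be chosen positive.
\<close>

definition forces_fractional_STS :: "real \<Rightarrow> real \<Rightarrow> bool" where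
  "forces_fractional_STS \<epsilon> \<delta> \<longleftrightarrow>
     (\<exists>n\<^sub>0::nat. \<forall>n\<ge>n\<^sub>0. \<forall>(V::nat set) E.
        three_uniform_hypergraph V E \<longrightarrow>
        card V = n \<longrightarrow>
        real (min_degree V (two_shadow E)) \<ge> (1 - \<epsilon>) * (real n - 1) \<longrightarrow>
        (\<forall>e\<in>two_shadow E. real (codegree E e) \<ge> \<delta> * (real n - 2)) \<longrightarrow>
        (\<exists>\<phi>. perfect_fractional_STS E \<phi>))"

text \<open>
  The set below is bounded below by \<open>0\<close>. It contains \<open>1\<close>: a hypergraph with at least three
  vertices satisfying the codegree condition for \<open>\<delta> = 1\<close> is empty or complete, and in the
  complete case the constant weight \<open>1 / (n - 2)\<close> works. So \<open>Inf\<close> is the genuine infimum.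
\<close>

definition \<delta>\<^sub>f :: "real \<Rightarrow> real" where
  "\<delta>\<^sub>f \<epsilon> = Inf {\<delta>. 0 \<le> \<delta> \<and> \<delta> \<le> 1 \<and> forces_fractional_STS \<epsilon> \<delta>}"

end

(*
  Let pi be a function on the shadow, and move weight pi(e) - pi(h) from e to h in each complete
  quadruple in which e and h are opposite pairs, by lowering the two triples over e and raising
  the two triples over h. Starting from constant triple weights, this corrects the pair sums by
  the Laplacian of pi in the graph of opposite pairs, so solving one Laplace equation makes all
  pair sums equal to 1. The triple weights stay nonnegative because pi varies little: two shadow
  pairs have many common opposite pairs, so the maximum principle bounds the oscillation of pi,
  and averaging the same argument over all quadruples through a triple gives the rest. If every
  shadow pair misses at most a n third vertices, the numerical condition is
    a (1 + (1 - (1 - 3a)^2) / ((1 - a)(1 - 5a))) <= 1/3,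
  which holds for a = 243/2000, so the codegree ratio 0.879 < (3 + sqrt 57)/12 suffices.
*)
theory Submission
  imports Defs
begin

section \<open>Square linear systems over the reals\<close>

text \<open>Gaussian elimination: an unknown occurring in equation \<open>i\<close> is eliminated
  from the other equations, which leaves one equation and one unknown fewer.\<close>

lemma homogeneous_system_nontrivial_solution:
  fixes a :: "'i \<Rightarrow> 'j \<Rightarrow> real"
  assumes "finite I" "finite J" "card I < card J"
  shows "\<exists>p. (\<exists>j\<in>J. p j \<noteq> 0) \<and> (\<forall>i\<in>I. (\<Sum>j\<in>J. a i j * p j) = 0)"
  using assms
proof (induction I arbitrary: J a rule: finite_induct)
  case empty
  then have "J \<noteq> {}" by auto
  then show ?case by (intro exI[of _ "\<lambda>_. 1"]) auto
next
  case (insert i I)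
  show ?case
  proof (cases "\<exists>j0\<in>J. a i j0 \<noteq> 0")
    case False
    obtain p where "\<exists>j\<in>J. p j \<noteq> 0" "\<forall>k\<in>I. (\<Sum>j\<in>J. a k j * p j) = 0"
      using insert.IH[of J a] insert.prems insert.hyps by auto
    then show ?thesis using False by (intro exI[of _ p]) auto
  next
    case True
    then obtain j0 where j0: "j0 \<in> J" "a i j0 \<noteq> 0" by blast
    define J' where "J' = J - {j0}"
    have J': "finite J'" "card I < card J'" "j0 \<notin> J'" "J = insert j0 J'"
      using insert.prems insert.hyps j0 by (auto simp: J'_def)
    obtain p where p: "\<exists>j\<in>J'. p j \<noteq> 0"
        "\<forall>k\<in>I. (\<Sum>j\<in>J'. (a k j - a k j0 * a i j / a i j0) * p j) = 0"
      using insert.IH[OF J'(1,2), of "\<lambda>k j. a k j - a k j0 * a i j / a i j0"] by blast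
    define s where "s = (\<Sum>j\<in>J'. a i j * p j)"
    \<comment> \<open>Back-substitution: the value at \<open>j0\<close> is the one that equation
      \<open>i\<close> forces.\<close>
    define q where "q = p(j0 := - s / a i j0)"
    have sum_q: "(\<Sum>j\<in>J. a k j * q j) = (\<Sum>j\<in>J'. a k j * p j) - a k j0 * s / a i j0" for k
    proof -
      have "(\<Sum>j\<in>J'. a k j * q j) = (\<Sum>j\<in>J'. a k j * p j)"
        using J'(3) by (intro sum.cong) (auto simp: q_def)
      then show ?thesis using J'(1,3) unfolding J'(4) by (simp add: q_def)
    qed
    have "(\<Sum>j\<in>J. a k j * q j) = 0" if "k \<in> insert i I" for k
    proof (cases "k = i")
      case True
      then show ?thesis using j0 by (simp add: sum_q s_def)
    next
      case False
      then have "0 = (\<Sum>j\<in>J'. (a k j - a k j0 * a i j / a i j0) * p j)" using p that by auto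
      also have "\<dots> = (\<Sum>j\<in>J'. a k j * p j) - a k j0 * s / a i j0"
        by (simp add: s_def sum_subtractf sum_distrib_left sum_divide_distrib algebra_simps)
      finally show ?thesis by (simp add: sum_q)
    qed
    moreover have "\<exists>j\<in>J. q j \<noteq> 0" using p(1) J'(3,4) by (auto simp: q_def)
    ultimately show ?thesis by blast
  qed
qed

text \<open>With \<open>- b\<close> as the column of an extra unknown \<open>None\<close>, the
  homogeneous system has more unknowns than equations. Injectivity keeps \<open>None\<close> from
  vanishing in a nontrivial solution, and dividing by its value solves the original system.\<close>

lemma injective_system_solvable:
  fixes a :: "'i \<Rightarrow> 'i \<Rightarrow> real"
  assumes fin: "finite I"
    and inj: "\<And>p. (\<And>i. i \<in> I \<Longrightarrow> (\<Sum>j\<in>I. a i j * p j) = 0) \<Longrightarrow> \<forall>i\<in>I. p i = 0"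
  shows "\<exists>p. \<forall>i\<in>I. (\<Sum>j\<in>I. a i j * p j) = b i"
proof -
  define J where "J = insert None (Some ` I)"
  have J: "finite J" "card I < card J"
    using fin by (auto simp: J_def card_image)
  define a' where "a' = (\<lambda>i j. case j of None \<Rightarrow> - b i | Some j \<Rightarrow> a i j)"
  obtain p where p: "\<exists>j\<in>J. p j \<noteq> 0" "\<forall>i\<in>I. (\<Sum>j\<in>J. a' i j * p j) = 0"
    using homogeneous_system_nontrivial_solution[OF fin J, of a'] by blast
  have eq: "(\<Sum>j\<in>I. a i j * p (Some j)) = b i * p None" if "i \<in> I" for i
  proof -
    have "0 = (\<Sum>j\<in>J. a' i j * p j)" using p that by auto
    also have "\<dots> = - b i * p None + (\<Sum>j\<in>I. a i j * p (Some j))"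
      using fin by (simp add: J_def a'_def sum.reindex)
    finally show ?thesis by simp
  qed
  have "p None \<noteq> 0"
  proof
    assume "p None = 0"
    then have "\<forall>i\<in>I. p (Some i) = 0" using inj[of "\<lambda>i. p (Some i)"] eq by auto
    then show False using p(1) \<open>p None = 0\<close> by (auto simp: J_def)
  qed
  then have "\<forall>i\<in>I. (\<Sum>j\<in>I. a i j * (p (Some j) / p None)) = b i"
    using eq by (simp add: sum_divide_distrib[symmetric])
  then show ?thesis by (intro exI[of _ "\<lambda>j. p (Some j) / p None"])
qed

section \<open>Counting by successive choices\<close>

lemma card_filter_conj_ge:
  assumes "finite V"
  shows "real (card {t \<in> V. P t \<and> Q t}) \<ge> real (card {t \<in> V. P t}) - real (card {t \<in> V. \<not> Q t})"
proof -
  have "card {t \<in> V. P t} \<le> card ({t \<in> V. P t \<and> Q t} \<union> {t \<in> V. \<not> Q t})"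
    using assms by (intro card_mono) auto
  also have "\<dots> \<le> card {t \<in> V. P t \<and> Q t} + card {t \<in> V. \<not> Q t}" by (rule card_Un_le)
  finally show ?thesis by linarith
qed

lemma card_Sigma_ge:
  assumes "finite A" "\<And>x. x \<in> A \<Longrightarrow> finite (B x)"
    and "\<alpha> \<le> real (card A)" "\<And>x. x \<in> A \<Longrightarrow> \<beta> \<le> real (card (B x))" "0 \<le> \<beta>"
  shows "\<alpha> * \<beta> \<le> real (card (Sigma A B))"
proof -
  have "\<alpha> * \<beta> \<le> real (card A) * \<beta>" using assms by (intro mult_right_mono) auto
  also have "\<dots> = (\<Sum>x\<in>A. \<beta>)" by simp
  also have "\<dots> \<le> (\<Sum>x\<in>A. real (card (B x)))" using assms by (intro sum_mono) auto
  also have "\<dots> = real (card (Sigma A B))" using assms by simp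
  finally show ?thesis .
qed

section \<open>Numerical inequalities\<close>

text \<open>Write a = 243/2000. The constant 141/400 lies just above a / ((1 - a) (1 - 5 a)), which
  belongs to the extremal case x = 0, y = a. Increasing x lowers the product by at most (2 - 6 a) x,
  and 141/400 of this is less than the loss x on the right.\<close>

lemma oscillation_numeric:
  fixes r x y :: real
  assumes "0 \<le> x" "x \<le> 243/2000" "0 \<le> y" "y \<le> 243/2000"
    and "r * ((1 - x - y) * (1 - x - y - 4 * (243/2000))) \<le> y - x"
  shows "r \<le> 141/400"
proof (rule ccontr)
  assume r: "\<not> ?thesis"
  define z where "z = (1 - x - y) * (1 - x - y - 4 * (243/2000))"
  have "1757/2000 * (785/2000) - x * (2542/2000) \<le> (1757/2000 - x) * (785/2000 - x)"
    using mult_nonneg_nonneg[OF assms(1) assms(1)] by (simp add: field_simps)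
  also have "\<dots> \<le> z"
    unfolding z_def using assms by (intro mult_mono) auto
  finally have "1757/2000 * (785/2000) - x * (2542/2000) \<le> z" .
  moreover have "141/400 * z \<le> r * z"
    unfolding z_def using r assms by (intro mult_right_mono mult_nonneg_nonneg) auto
  ultimately show False using assms(1,4) assms(5)[folded z_def] by simp
qed

text \<open>The parameters are moved to the extremal point r = 141/400, k = s, x = 0, s = 1, where
  the left side is a + 141/400 (1 - (1 - 3 a)^2) with a = 243/2000, just below 1/3.\<close>

lemma star_numeric:
  fixes r x s k :: real
  assumes x: "0 \<le> x" "x \<le> 243/2000" and r: "0 \<le> r" "r \<le> 141/400"
    and k: "0 \<le> k" "k \<le> s" and s: "1757/2000 \<le> s" "s \<le> 1"
  shows "k * (243/2000 - x) + r * (k - (s - x) * (1 - x - 3 * (243/2000)) * (k - 3 * (243/2000))) \<le> 1/3"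
proof -
  define c :: real where "c = 1271/2000"
  define B where "B = (s - x) * (c - x)"
  have "B \<le> 1 * 1" unfolding B_def c_def using x s by (intro mult_mono) auto
  moreover have B0: "0 \<le> B" unfolding B_def c_def using x s by (intro mult_nonneg_nonneg) auto
  ultimately have kB: "0 \<le> k * (1 - B)" "k * (1 - B) \<le> s * (1 - B)"
    using k by (auto intro!: mult_right_mono)
  have BL: "s * c - x * (s + c) \<le> B" using x by (simp add: B_def algebra_simps)
  have "r * (k - B * (k - 729/2000)) \<le> 141/400 * (k * (1 - B) + 729/2000 * B)"
    using mult_right_mono[OF r(2), of "k * (1 - B) + 729/2000 * B"] kB(1) B0 by (simp add: algebra_simps)
  moreover have "k * (243/2000 - x) \<le> s * (243/2000 - x)" using k x by (intro mult_right_mono) auto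
  ultimately have "k * (243/2000 - x) + r * (k - B * (k - 729/2000))
      \<le> s * (243/2000 - x) + 141/400 * (s - B * (s - 729/2000))"
    using kB(2) by (simp add: algebra_simps)
  also have "\<dots> \<le> s * (243/2000 - x) + 141/400 * (s - (s * c - x * (s + c)) * (s - 729/2000))"
    using mult_right_mono[OF BL, of "s - 729/2000"] s by simp
  \<comment> \<open>Isolating \<open>x\<close> exposes a nonnegative factor, so \<open>x = 0\<close>
    is the worst case. The factor \<open>1 - s\<close> is treated in the same way further
    down.\<close>
  also have "\<dots> = s * (243/2000) + 141/400 * (s - s * c * (s - 729/2000))
      - x * (s - 141/400 * ((s + c) * (s - 729/2000)))"
    by (simp add: field_simps)
  also have "\<dots> \<le> s * (243/2000) + 141/400 * (s - s * c * (s - 729/2000))"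
  proof -
    have "(s + c) * (s - 729/2000) \<le> 2 * s" unfolding c_def using s by (intro mult_mono) auto
    then have "0 \<le> s - 141/400 * ((s + c) * (s - 729/2000))" using s by linarith
    from mult_nonneg_nonneg[OF x(1) this] show ?thesis by linarith
  qed
  also have "\<dots> = 243/2000 + 141/400 * (1 - c * (1271/2000))
      - (1 - s) * (243/2000 + 141/400 + 729/2000 * (141/400) * c - 141/400 * c * (1 + s))"
    by (simp add: field_simps)
  also have "\<dots> \<le> 243/2000 + 141/400 * (1 - c * (1271/2000))"
  proof -
    have "0 \<le> (1 - s) * (243/2000 + 141/400 + 729/2000 * (141/400) * c - 141/400 * c * (1 + s))"
      using s by (intro mult_nonneg_nonneg) (auto simp: c_def)
    then show ?thesis by linarith
  qed
  also have "\<dots> \<le> 1/3" by (simp add: c_def)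
  finally show ?thesis by (simp add: B_def c_def)
qed

section \<open>Dense triple systems, opposite pairs and the maximum principle\<close>

text \<open>The edges are encoded as a symmetric relation on ordered triples. The density 243/2000
  exceeds 1 - 879/1000 by 1/2000; this slack absorbs the \<open>- 2\<close> of the codegree
  condition for large vertex sets.\<close>

locale dense_triple_system =
  fixes V :: "'a set" and T :: "'a \<Rightarrow> 'a \<Rightarrow> 'a \<Rightarrow> bool"
  assumes finite_V: "finite V"
    and T_V: "T x y z \<Longrightarrow> x \<in> V"
    and T_swap12: "T x y z \<longleftrightarrow> T y x z"
    and T_swap23: "T x y z \<longleftrightarrow> T x z y"
    and few_missing: "T x y z \<Longrightarrow> real (card {t \<in> V. \<not> T x y t}) \<le> 243/2000 * real (card V)"
begin

definition n :: real where "n = real (card V)"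

definition missing :: "'a \<times> 'a \<Rightarrow> real" where
  "missing e = real (card {t \<in> V. \<not> T (fst e) (snd e) t})"

definition shadow :: "('a \<times> 'a) set" where "shadow = {(u, v). \<exists>x. T u v x}"

definition K4 :: "'a \<Rightarrow> 'a \<Rightarrow> 'a \<Rightarrow> 'a \<Rightarrow> bool" where
  "K4 u v x y \<longleftrightarrow> T u v x \<and> T u v y \<and> T u x y \<and> T v x y"

text \<open>Pairs are ordered, so each opposite pair occurs in both orders. This matches iterated
  sums over a third vertex \<open>x\<close> and then a fourth vertex \<open>y\<close>.\<close>

definition opp :: "'a \<times> 'a \<Rightarrow> ('a \<times> 'a) set" where
  "opp e = {(x, y). K4 (fst e) (snd e) x y}"

definition laplacian :: "('a \<times> 'a \<Rightarrow> real) \<Rightarrow> 'a \<times> 'a \<Rightarrow> real" where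
  "laplacian p e = (\<Sum>h\<in>opp e. p e - p h)"

lemma T_V': "T x y z \<Longrightarrow> x \<in> V \<and> y \<in> V \<and> z \<in> V"
  using T_V T_swap12 T_swap23 by blast

lemma T_rot: "T x y z \<longleftrightarrow> T y z x"
  using T_swap12 T_swap23 by blast

lemma shadowI: "T u v x \<Longrightarrow> (u, v) \<in> shadow"
  by (auto simp: shadow_def)

lemma shadow_V: "shadow \<subseteq> V \<times> V"
  using T_V' by (auto simp: shadow_def)

lemma finite_shadow: "finite shadow"
  using finite_subset[OF shadow_V] finite_V by blast

lemma shadow_swap: "(u, v) \<in> shadow \<longleftrightarrow> (v, u) \<in> shadow"
  using T_swap12 by (auto simp: shadow_def)

lemma K4_swap12: "K4 u v x y \<longleftrightarrow> K4 v u x y"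
  and K4_swap34: "K4 u v x y \<longleftrightarrow> K4 u v y x"
  and K4_swap23: "K4 u v x y \<longleftrightarrow> K4 u x v y"
  and K4_pairs: "K4 u v x y \<longleftrightarrow> K4 x y u v"
  unfolding K4_def using T_swap12 T_swap23 by blast+

lemma opp_shadow: "opp e \<subseteq> shadow"
  unfolding opp_def K4_def shadow_def using T_rot by blast

lemma finite_opp: "finite (opp e)"
  using finite_subset[OF opp_shadow finite_shadow] .

lemma opp_sym: "h \<in> opp e \<longleftrightarrow> e \<in> opp h"
  using K4_pairs by (cases e; cases h) (auto simp: opp_def)

lemma missing_nonneg: "0 \<le> missing e"
  by (simp add: missing_def)

lemma missing_le: "e \<in> shadow \<Longrightarrow> missing e \<le> 243/2000 * n"
  using few_missing by (auto simp: shadow_def missing_def n_def)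

lemma missing_le': "T u v x \<Longrightarrow> missing (u, v) \<le> 243/2000 * n"
  using missing_le shadowI by blast

lemma card_nbrs: "real (card {t \<in> V. T u v t}) = n - missing (u, v)"
proof -
  have "card V = card {t \<in> V. T u v t} + card {t \<in> V. \<not> T u v t}"
    using finite_V by (subst card_Un_disjoint[symmetric]) (auto intro: arg_cong[of _ _ card])
  then show ?thesis by (simp add: n_def missing_def)
qed

text \<open>Each further adjacency condition costs at most \<open>missing\<close> of its pair.
  Repeated introduction peels a left-nested conjunction, which is why the sets below are nested that
  way.\<close>

lemma card_conj_nbrs_ge:
  assumes "r \<le> real (card {t \<in> V. P t})"
  shows "r - missing (u, v) \<le> real (card {t \<in> V. P t \<and> T u v t})"
  using card_filter_conj_ge[OF finite_V, of P "T u v"] assms by (simp add: missing_def)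

text \<open>A common opposite pair \<open>(x, y)\<close> is chosen vertex by vertex:
  \<open>x\<close> must complete both \<open>e\<close> and \<open>g\<close>, and \<open>y\<close>
  must do so as well and also complete the four pairs that join \<open>x\<close> to the ends of
  \<open>e\<close> and \<open>g\<close>.\<close>

lemma card_opp_Int_ge:
  assumes "e \<in> shadow" "g \<in> shadow"
  shows "(n - missing e - missing g) * (n - missing e - missing g - 4 * (243/2000 * n))
    \<le> real (card (opp e \<inter> opp g))"
proof -
  obtain u v u' v' where e: "e = (u, v)" "g = (u', v')" by (cases e; cases g) auto
  define A where "A = {t \<in> V. T u v t \<and> T u' v' t}"
  define B where "B x = {t \<in> V. ((((T u v t \<and> T u' v' t) \<and> T u x t) \<and> T v x t) \<and> T u' x t) \<and> T v' x t}" for x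
  have A: "n - missing e - missing g \<le> real (card A)"
    unfolding A_def e by (intro card_conj_nbrs_ge) (simp add: card_nbrs)
  have "n - missing e - missing g - 4 * (243/2000 * n) \<le> real (card (B x))" if "x \<in> A" for x
  proof -
    have "n - missing e - missing g - missing (u, x) - missing (v, x) - missing (u', x) - missing (v', x)
      \<le> real (card (B x))"
      unfolding B_def e by (intro card_conj_nbrs_ge) (simp add: card_nbrs)
    moreover have "T u x v" "T v x u" "T u' x v'" "T v' x u'"
      using that T_swap12 T_swap23 by (auto simp: A_def)
    ultimately show ?thesis
      using missing_le'[of u x v] missing_le'[of v x u] missing_le'[of u' x v'] missing_le'[of v' x u']
      by linarith
  qed
  moreover have "0 \<le> n - missing e - missing g - 4 * (243/2000 * n)"
    using missing_le[OF assms(1)] missing_le[OF assms(2)] by (auto simp: n_def)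
  ultimately have "(n - missing e - missing g) * (n - missing e - missing g - 4 * (243/2000 * n))
      \<le> real (card (Sigma A B))"
    using A finite_V by (intro card_Sigma_ge) (auto simp: A_def B_def)
  also have "\<dots> \<le> real (card (opp e \<inter> opp g))"
    using finite_opp by (intro of_nat_mono card_mono) (auto simp: A_def B_def opp_def K4_def e)
  finally show ?thesis .
qed

text \<open>The maximum principle: at a maximum \<open>e\<close> and a minimum \<open>g\<close> of \<open>p\<close> all summands of both
  Laplacians have a favourable sign, so only the common neighbours need to be kept.\<close>

lemma oscillation_bound:
  assumes e: "e \<in> shadow" "\<And>h. h \<in> shadow \<Longrightarrow> p h \<le> p e"
    and g: "g \<in> shadow" "\<And>h. h \<in> shadow \<Longrightarrow> p g \<le> p h"
  shows "(p e - p g) * real (card (opp e \<inter> opp g)) \<le> laplacian p e - laplacian p g"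
proof -
  have "(p e - p g) * real (card (opp e \<inter> opp g))
      = (\<Sum>h\<in>opp e \<inter> opp g. p e - p h) + (\<Sum>h\<in>opp e \<inter> opp g. p h - p g)"
    by (simp add: sum.distrib[symmetric])
  also have "(\<Sum>h\<in>opp e \<inter> opp g. p e - p h) \<le> laplacian p e"
    unfolding laplacian_def using e(2) opp_shadow[of e] finite_opp
    by (intro sum_mono2) auto
  also have "(\<Sum>h\<in>opp e \<inter> opp g. p h - p g) \<le> (\<Sum>h\<in>opp g. p h - p g)"
    using g(2) opp_shadow[of g] finite_opp by (intro sum_mono2) auto
  also have "\<dots> = - laplacian p g"
    by (simp add: laplacian_def sum_negf[symmetric])
  finally show ?thesis by simp
qed

section \<open>Kernel and solvability of the Laplacian\<close>

lemma n_pos: "e \<in> shadow \<Longrightarrow> 0 < n"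
  using shadow_V finite_V by (auto simp: n_def card_gt_0_iff)

lemma ex_maximum:
  assumes "shadow \<noteq> {}"
  shows "\<exists>e\<in>shadow. \<forall>h\<in>shadow. (p h :: real) \<le> p e"
proof -
  have "Max (p ` shadow) \<in> p ` shadow" using finite_shadow assms by (intro Max_in) auto
  then obtain e where "e \<in> shadow" "Max (p ` shadow) = p e" by blast
  then show ?thesis using finite_shadow Max_ge[of "p ` shadow"] by auto
qed

lemma ex_minimum:
  assumes "shadow \<noteq> {}"
  shows "\<exists>e\<in>shadow. \<forall>h\<in>shadow. p e \<le> (p h :: real)"
  using ex_maximum[OF assms, of "\<lambda>h. - p h"] by simp

text \<open>A maximum and a minimum have a common opposite pair, since 6 * 243/2000 < 1, so the
  maximum principle with zero Laplacian leaves no oscillation.\<close>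

lemma laplacian_zero_constant:
  assumes zero: "\<And>e. e \<in> shadow \<Longrightarrow> laplacian p e = 0" and "h \<in> shadow" "h' \<in> shadow"
  shows "p h = p h'"
proof -
  obtain e where e: "e \<in> shadow" "\<forall>h\<in>shadow. p h \<le> p e" using ex_maximum assms(2) by blast
  obtain g where g: "g \<in> shadow" "\<forall>h\<in>shadow. p g \<le> p h" using ex_minimum assms(2) by blast
  have "(p e - p g) * real (card (opp e \<inter> opp g)) \<le> 0"
    using oscillation_bound[of e p g] e g zero by auto
  moreover have "0 < (n - missing e - missing g) * (n - missing e - missing g - 4 * (243/2000 * n))"
    using missing_le[OF e(1)] missing_le[OF g(1)] n_pos[OF e(1)] by (intro mult_pos_pos) linarith+
  then have "0 < real (card (opp e \<inter> opp g))" using card_opp_Int_ge[OF e(1) g(1)] by linarith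
  ultimately have "p e \<le> p g" by (simp add: mult_le_0_iff)
  then show ?thesis using e g assms(2,3) by (metis order_antisym)
qed

text \<open>Adding the all-ones matrix to the Laplacian removes the constants from its kernel.
  Laplacians sum to zero, so for a right-hand side of sum zero every solution of the modified system
  has sum zero, and the added matrix contributes nothing.\<close>

lemma laplacian_solvable:
  assumes "(\<Sum>e\<in>shadow. b e) = 0"
  shows "\<exists>p. \<forall>e\<in>shadow. laplacian p e = b e"
proof (cases "shadow = {}")
  case False
  \<comment> \<open>The final \<open>+ 1\<close> is the all-ones matrix.\<close>
  define a where "a = (\<lambda>e h. (if h = e then real (card (opp e)) else 0) - (if h \<in> opp e then 1 else 0) + 1)"
  have row: "(\<Sum>h\<in>shadow. a e h * p h) = laplacian p e + sum p shadow" if "e \<in> shadow" for e p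
  proof -
    have "(\<Sum>h\<in>shadow. a e h * p h)
      = (\<Sum>h\<in>shadow. (if h = e then real (card (opp e)) * p h else 0))
        - (\<Sum>h\<in>shadow. (if h \<in> opp e then p h else 0)) + sum p shadow"
      unfolding a_def sum_subtractf[symmetric] sum.distrib[symmetric]
      by (intro sum.cong) (auto simp: algebra_simps)
    also have "(\<Sum>h\<in>shadow. (if h \<in> opp e then p h else 0)) = sum p (opp e)"
      using opp_shadow[of e] finite_shadow by (simp add: sum.inter_restrict[symmetric] Int_absorb1)
    finally show ?thesis using that finite_shadow by (simp add: laplacian_def sum_subtractf)
  qed
  \<comment> \<open>The relation \<open>opp\<close> is symmetric, so exchanging the order of
    summation makes the two halves cancel.\<close>
  have total: "(\<Sum>e\<in>shadow. laplacian p e) = 0" for p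
  proof -
    have opp_eq: "{h \<in> shadow. h \<in> opp e} = opp e" "{h \<in> shadow. e \<in> opp h} = opp e" for e
      using opp_shadow[of e] opp_sym[of _ e] by auto
    have "(\<Sum>e\<in>shadow. \<Sum>h\<in>opp e. p h) = (\<Sum>e\<in>shadow. \<Sum>h | h \<in> shadow \<and> h \<in> opp e. p h)"
      by (simp add: opp_eq)
    also have "\<dots> = (\<Sum>h\<in>shadow. \<Sum>e | e \<in> shadow \<and> h \<in> opp e. p h)"
      by (rule sum.swap_restrict[OF finite_shadow finite_shadow])
    also have "\<dots> = (\<Sum>h\<in>shadow. \<Sum>e\<in>opp h. p h)" by (simp only: opp_eq)
    finally show ?thesis by (simp add: laplacian_def sum_subtractf)
  qed
  have total': "sum p shadow = 0"
    if "\<And>e. e \<in> shadow \<Longrightarrow> (\<Sum>h\<in>shadow. a e h * p h) = b' e" "sum b' shadow = 0" for p b'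
  proof -
    have "0 = (\<Sum>e\<in>shadow. laplacian p e + sum p shadow)"
      using that row by simp
    then show ?thesis using total[of p] False finite_shadow by (simp add: sum.distrib)
  qed
  have "\<exists>p. \<forall>e\<in>shadow. (\<Sum>h\<in>shadow. a e h * p h) = b e"
  proof (rule injective_system_solvable[OF finite_shadow], intro ballI)
    fix p e assume p: "\<And>e. e \<in> shadow \<Longrightarrow> (\<Sum>h\<in>shadow. a e h * p h) = 0" and e: "e \<in> shadow"
    have sum0: "sum p shadow = 0" using total'[of p "\<lambda>_. 0"] p by simp
    have "laplacian p e = 0" if "e \<in> shadow" for e using p[OF that] row[OF that, of p] sum0 by simp
    then have "p h = p e" if "h \<in> shadow" for h using laplacian_zero_constant that e by blast
    then have "sum p shadow = real (card shadow) * p e" by simp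
    then show "p e = 0" using sum0 False finite_shadow by simp
  qed
  then obtain p where p: "\<forall>e\<in>shadow. (\<Sum>h\<in>shadow. a e h * p h) = b e" by blast
  then have "sum p shadow = 0" using total'[of p b] assms by simp
  then show ?thesis using p row by (intro exI[of _ p]) auto
qed simp

text \<open>Reversing all pairs is an automorphism of the graph of opposite pairs.\<close>

lemma laplacian_swap:
  "laplacian (\<lambda>(u, v). p (v, u)) (u, v) = laplacian p (v, u)"
  unfolding laplacian_def
  by (rule sum.reindex_bij_witness[of _ prod.swap prod.swap])
    (auto simp: opp_def intro: K4_swap12[THEN iffD1] K4_swap34[THEN iffD1])

text \<open>A solution is averaged with its reversal. The symmetry makes the triple weights built
  from \<open>p\<close> independent of the order of the vertices.\<close>

lemma laplacian_solvable_symmetric: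
  assumes "(\<Sum>e\<in>shadow. b e) = 0" "\<And>u v. b (u, v) = b (v, u)"
  shows "\<exists>p. (\<forall>e\<in>shadow. laplacian p e = b e) \<and> (\<forall>u v. p (u, v) = p (v, u))"
proof -
  obtain p where p: "\<forall>e\<in>shadow. laplacian p e = b e" using laplacian_solvable assms(1) by blast
  define q where "q = (\<lambda>(u, v). (p (u, v) + p (v, u)) / 2)"
  have avg: "laplacian q (u, v) = (laplacian p (u, v) + laplacian (\<lambda>(u, v). p (v, u)) (u, v)) / 2" for u v
    unfolding laplacian_def q_def
    by (simp add: sum.distrib[symmetric] sum_divide_distrib case_prod_beta add_divide_distrib diff_divide_distrib
        algebra_simps)
  have "laplacian q (u, v) = b (u, v)" if "(u, v) \<in> shadow" for u v
  proof -
    have "laplacian p (u, v) = b (u, v)" "laplacian p (v, u) = b (u, v)"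
      using p that assms(2)[of u v] shadow_swap[of u v] by auto
    then show ?thesis by (simp add: avg laplacian_swap)
  qed
  then show ?thesis by (intro exI[of _ q]) (auto simp: q_def)
qed

section \<open>Quantitative bounds on the potential\<close>

text \<open>The maximum principle combined with the count of common opposite pairs, divided by
  \<open>n\<close>, is the hypothesis of \<open>oscillation_numeric\<close> for the densities
  \<open>missing e / n\<close> and \<open>missing g / n\<close>.\<close>

lemma oscillation_le:
  assumes lap: "\<And>e g. e \<in> shadow \<Longrightarrow> g \<in> shadow \<Longrightarrow> laplacian p e - laplacian p g = missing g - missing e"
    and e: "e \<in> shadow" "\<And>h. h \<in> shadow \<Longrightarrow> p h \<le> p e"
    and g: "g \<in> shadow" "\<And>h. h \<in> shadow \<Longrightarrow> p g \<le> p h"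
  shows "(p e - p g) * n \<le> 141/400"
proof (rule oscillation_numeric)
  have n: "0 < n" using n_pos e(1) .
  show "0 \<le> missing e / n" "0 \<le> missing g / n" using missing_nonneg n by auto
  show "missing e / n \<le> 243/2000" "missing g / n \<le> 243/2000"
    using missing_le[OF e(1)] missing_le[OF g(1)] n by (auto simp: field_simps)
  have "(p e - p g) * ((n - missing e - missing g) * (n - missing e - missing g - 4 * (243/2000 * n)))
      \<le> (p e - p g) * real (card (opp e \<inter> opp g))"
    using card_opp_Int_ge[OF e(1) g(1)] e(2)[OF g(1)] by (intro mult_left_mono) auto
  also have "\<dots> \<le> missing g - missing e"
    using oscillation_bound[of e p g] e g lap[OF e(1) g(1)] by simp
  finally have "(p e - p g) * ((n - missing e - missing g) * (n - missing e - missing g - 4 * (243/2000 * n))) / n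
      \<le> (missing g - missing e) / n" using n by (simp add: divide_right_mono)
  moreover have "(p e - p g) * n * ((1 - x / n - y / n) * (1 - x / n - y / n - 4 * (243/2000)))
      = (p e - p g) * ((n - x - y) * (n - x - y - 4 * (243/2000 * n))) / n" for x y
    using n by (simp add: field_simps)
  ultimately show "(p e - p g) * n * ((1 - missing e / n - missing g / n) * (1 - missing e / n - missing g / n - 4 * (243/2000)))
      \<le> missing g / n - missing e / n"
    by (simp add: diff_divide_distrib)
qed

text \<open>Unlike in the maximum principle, \<open>e\<close> and \<open>g\<close> need not be
  extremal. A common opposite pair contributes exactly \<open>p e - p g\<close> to the difference;
  each other element of \<open>V \<times> V\<close> contributes at least
  \<open>p e - p g - (M - m)\<close>.\<close>

lemma laplacian_difference_ge:
  assumes e: "e \<in> shadow" and g: "g \<in> shadow"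
    and p: "\<And>h. h \<in> shadow \<Longrightarrow> m \<le> p h" "\<And>h. h \<in> shadow \<Longrightarrow> p h \<le> M"
  shows "n\<^sup>2 * (p e - p g - (M - m)) + (M - m) * real (card (opp e \<inter> opp g)) \<le> laplacian p e - laplacian p g"
proof -
  have fin: "finite (V \<times> V)" using finite_V by simp
  have sub: "opp h \<subseteq> V \<times> V" for h using opp_shadow shadow_V by blast
  have "n\<^sup>2 * (p e - p g - (M - m)) + (M - m) * real (card (opp e \<inter> opp g))
      = (\<Sum>h\<in>V \<times> V. (p e - p g - (M - m)) + (if h \<in> opp e \<inter> opp g then M - m else 0))"
    using sub[of e] fin
    by (simp add: sum.distrib n_def power2_eq_square sum.inter_restrict[symmetric] Int_absorb1 le_infI1
        card_cartesian_product del: Int_iff)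
  also have "\<dots> \<le> (\<Sum>h\<in>V \<times> V. (if h \<in> opp e then p e - p h else 0) + (if h \<in> opp g then p h - p g else 0))"
  proof (rule sum_mono)
    fix h
    show "(p e - p g - (M - m)) + (if h \<in> opp e \<inter> opp g then M - m else 0)
      \<le> (if h \<in> opp e then p e - p h else 0) + (if h \<in> opp g then p h - p g else 0)"
      using p(1)[OF g] p(2)[OF g] p(1)[OF e] p(2)[OF e] p[of h] opp_shadow[of e] opp_shadow[of g] by auto
  qed
  also have "\<dots> = laplacian p e + (\<Sum>h\<in>opp g. p h - p g)"
    using sub[of e] sub[of g] fin
    by (simp add: sum.distrib laplacian_def sum.inter_restrict[symmetric] Int_absorb1)
  also have "(\<Sum>h\<in>opp g. p h - p g) = - laplacian p g"
    by (simp add: laplacian_def sum_negf[symmetric])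
  finally show ?thesis by simp
qed

text \<open>The right side counts triples \<open>(x, x', y)\<close>. Choosing \<open>y\<close> last,
  inside \<open>Y\<close>, costs only the three pairs within \<open>{w, x, x'}\<close>. At the
  choice of \<open>x\<close>, only the \<open>\<eta>\<close> vertices not paired with
  \<open>w\<close> in the shadow are excluded in addition to those missing at
  \<open>(u, v)\<close>.\<close>

lemma card_common_opposite_ge:
  assumes T: "T u v w"
  defines "Y \<equiv> {y \<in> V. K4 u v w y}" and "\<eta> \<equiv> real (card {t \<in> V. (w, t) \<notin> shadow})"
  shows "(n - missing (u, v) - \<eta>) * (n - missing (u, v) - 3 * (243/2000 * n)) * (real (card Y) - 3 * (243/2000 * n))
    \<le> (\<Sum>y\<in>Y. real (card (opp (u, v) \<inter> opp (w, y))))"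
proof -
  define A where "A = {t \<in> V. T u v t \<and> (w, t) \<in> shadow}"
  define B where "B x = {t \<in> V. ((T u v t \<and> T u x t) \<and> T v x t) \<and> T w x t}" for x
  define C where "C = (\<lambda>(x, x'). {t \<in> V. ((K4 u v w t \<and> T w x t) \<and> T w x' t) \<and> T x x' t})"
  have fin: "finite A" "finite (B x)" "finite (C h)" for x h
    using finite_V by (auto simp: A_def B_def C_def split: prod.split)
  have n: "0 < n" using n_pos T shadowI by blast
  have miss: "missing (u, v) \<le> 243/2000 * n" "missing (u, w) \<le> 243/2000 * n" "missing (v, w) \<le> 243/2000 * n"
    using T missing_le' T_swap12 T_swap23 by blast+
  have A: "n - missing (u, v) - \<eta> \<le> real (card A)"
    using card_filter_conj_ge[OF finite_V, of "T u v" "\<lambda>t. (w, t) \<in> shadow"]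
    by (simp add: A_def \<eta>_def card_nbrs)
  have B: "n - missing (u, v) - 3 * (243/2000 * n) \<le> real (card (B x))" if "x \<in> A" for x
  proof -
    have "n - missing (u, v) - missing (u, x) - missing (v, x) - missing (w, x) \<le> real (card (B x))"
      unfolding B_def by (intro card_conj_nbrs_ge) (simp add: card_nbrs)
    moreover have "T u x v" "T v x u" "(w, x) \<in> shadow"
      using that T_swap12 T_swap23 by (auto simp: A_def)
    ultimately show ?thesis
      using missing_le'[of u x v] missing_le'[of v x u] missing_le[of "(w, x)"] by linarith
  qed
  have C: "real (card Y) - 3 * (243/2000 * n) \<le> real (card (C h))" if "h \<in> Sigma A B" for h
  proof -
    obtain x x' where h: "h = (x, x')" by (cases h)
    have "real (card Y) - missing (w, x) - missing (w, x') - missing (x, x') \<le> real (card (C h))"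
      unfolding C_def h prod.case by (intro card_conj_nbrs_ge) (simp add: Y_def)
    moreover have "T w x x'" "T w x' x" "T x x' w"
      using that T_swap12 T_swap23 by (auto simp: B_def h)
    ultimately show ?thesis
      using missing_le'[of w x x'] missing_le'[of w x' x] missing_le'[of x x' w] by linarith
  qed
  \<comment> \<open>\<open>card_Sigma_ge\<close> needs a nonnegative fibre bound; it follows from 6
    * 243/2000 < 1.\<close>
  have "n - missing (u, v) - missing (u, w) - missing (v, w) \<le> real (card {t \<in> V. (T u v t \<and> T u w t) \<and> T v w t})"
    by (intro card_conj_nbrs_ge) (simp add: card_nbrs)
  also have "{t \<in> V. (T u v t \<and> T u w t) \<and> T v w t} = Y"
    using T by (auto simp: Y_def K4_def)
  finally have Y: "0 \<le> real (card Y) - 3 * (243/2000 * n)" using miss n by linarith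
  have "(n - missing (u, v) - \<eta>) * (n - missing (u, v) - 3 * (243/2000 * n)) \<le> real (card (Sigma A B))"
    using A B fin miss n by (intro card_Sigma_ge) auto
  from card_Sigma_ge[where B = C, OF _ _ this C Y] have "(n - missing (u, v) - \<eta>) * (n - missing (u, v) - 3 * (243/2000 * n)) * (real (card Y) - 3 * (243/2000 * n))
      \<le> real (card (Sigma (Sigma A B) C))"
    using fin by blast
  also have "card (Sigma (Sigma A B) C) = card (prod.swap ` Sigma (Sigma A B) C)"
    by (simp add: card_image)
  also have "\<dots> \<le> card (SIGMA y:Y. opp (u, v) \<inter> opp (w, y))"
  proof (intro card_mono)
    show "finite (SIGMA y:Y. opp (u, v) \<inter> opp (w, y))"
      using finite_V finite_opp by (auto simp: Y_def)
    show "prod.swap ` Sigma (Sigma A B) C \<subseteq> (SIGMA y:Y. opp (u, v) \<inter> opp (w, y))"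
    proof (clarsimp, intro conjI)
      fix x x' y assume *: "x \<in> A" "x' \<in> B x" "y \<in> C (x, x')"
      show "y \<in> Y" using * by (auto simp: C_def Y_def)
      show "(x, x') \<in> opp (u, v)" using * by (auto simp: A_def B_def opp_def K4_def)
      have "T y x x'" using * T_rot[of y x x'] by (auto simp: C_def)
      then show "(x, x') \<in> opp (w, y)"
        using * T_swap23[of w y x] T_swap23[of w y x'] by (auto simp: B_def C_def opp_def K4_def)
    qed
  qed
  also have "\<dots> = (\<Sum>y\<in>Y. card (opp (u, v) \<inter> opp (w, y)))"
    using finite_V finite_opp by (simp add: Y_def)
  finally show ?thesis by simp
qed

text \<open>For a single \<open>y\<close> the common neighbourhood is only known to have density
  \<open>(1 - a) (1 - 5 a)\<close>, where \<open>a = 243/2000\<close>, and the resulting bound exceeds \<open>1/3\<close>. Averaging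
  over \<open>y\<close> raises the density to \<open>(1 - 3 a)\<^sup>2\<close>, which suffices.\<close>

lemma star_sum_le:
  assumes lap: "\<And>e g. e \<in> shadow \<Longrightarrow> g \<in> shadow \<Longrightarrow> laplacian p e - laplacian p g = missing g - missing e"
    and T: "T u v w"
  shows "(\<Sum>y | y \<in> V \<and> K4 u v w y. p (u, v) - p (w, y)) \<le> 1/3"
proof -
  define Y where "Y = {y \<in> V. K4 u v w y}"
  define \<eta> where "\<eta> = real (card {t \<in> V. (w, t) \<notin> shadow})"
  define k where "k = real (card Y)"
  define X where "X = missing (u, v)"
  define S where "S = (\<Sum>y\<in>Y. real (card (opp (u, v) \<inter> opp (w, y))))"
  have e: "(u, v) \<in> shadow" using shadowI T .
  have n: "0 < n" using n_pos e .
  have X: "0 \<le> X" "X \<le> 243/2000 * n" using missing_nonneg missing_le e by (auto simp: X_def)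
  obtain eM where eM: "eM \<in> shadow" "\<forall>h\<in>shadow. p h \<le> p eM" using ex_maximum e by blast
  obtain em where em: "em \<in> shadow" "\<forall>h\<in>shadow. p em \<le> p h" using ex_minimum e by blast
  define R where "R = p eM - p em"
  have R: "0 \<le> R" "R * n \<le> 141/400"
    unfolding R_def using oscillation_le[OF lap eM(1) _ em(1)] eM em by auto
  have Y_shadow: "(w, y) \<in> shadow" if "y \<in> Y" for y
    using that shadowI[of w y u] T_rot[of u w y] by (auto simp: Y_def K4_def)
  \<comment> \<open>The difference of Laplacians is \<open>missing (w, y) - X\<close>, and
    \<open>missing (w, y)\<close> is at most \<open>243/2000 * n\<close>.\<close>
  have "n\<^sup>2 * (p (u, v) - p (w, y) - R) + R * real (card (opp (u, v) \<inter> opp (w, y))) \<le> 243/2000 * n - X"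
    if "y \<in> Y" for y
    using laplacian_difference_ge[OF e Y_shadow[OF that], of "p em" p "p eM"] eM em
      lap[OF e Y_shadow[OF that]] missing_le[OF Y_shadow[OF that]] by (auto simp: X_def R_def)
  then have "(\<Sum>y\<in>Y. n\<^sup>2 * (p (u, v) - p (w, y) - R) + R * real (card (opp (u, v) \<inter> opp (w, y))))
      \<le> (\<Sum>y\<in>Y. 243/2000 * n - X)" by (rule sum_mono)
  moreover have "(\<Sum>y\<in>Y. n\<^sup>2 * (p (u, v) - p (w, y) - R) + R * real (card (opp (u, v) \<inter> opp (w, y))))
      = n\<^sup>2 * (\<Sum>y\<in>Y. p (u, v) - p (w, y)) - n\<^sup>2 * k * R + R * S"
    by (simp add: S_def k_def sum.distrib sum_distrib_left sum_subtractf right_diff_distrib)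
  ultimately have 1: "n\<^sup>2 * (\<Sum>y\<in>Y. p (u, v) - p (w, y)) \<le> k * (243/2000 * n - X) + R * (k * n\<^sup>2 - S)"
    by (simp add: k_def algebra_simps)
  have "R * (k * n\<^sup>2 - S) \<le> R * (k * n\<^sup>2 - (n - X - \<eta>) * (n - X - 3 * (243/2000 * n)) * (k - 3 * (243/2000 * n)))"
    using card_common_opposite_ge[OF T] R(1)
    by (intro mult_left_mono) (auto simp: S_def X_def \<eta>_def k_def Y_def)
  with 1 have "(\<Sum>y\<in>Y. p (u, v) - p (w, y))
      \<le> (k * (243/2000 * n - X) + R * (k * n\<^sup>2 - (n - X - \<eta>) * (n - X - 3 * (243/2000 * n)) * (k - 3 * (243/2000 * n)))) / n\<^sup>2"
    using n by (simp add: pos_le_divide_eq mult.commute)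
  also have "\<dots> = k / n * (243/2000 - X / n) + R * n * (k / n - ((1 - \<eta> / n) - X / n) * (1 - X / n - 3 * (243/2000)) * (k / n - 3 * (243/2000)))"
    using n by (simp add: field_simps power2_eq_square)
  also have "\<dots> \<le> 1/3"
  proof (rule star_numeric)
    show "0 \<le> X / n" "X / n \<le> 243/2000" "0 \<le> R * n" "R * n \<le> 141/400" "0 \<le> k / n" "1 - \<eta> / n \<le> 1"
      using X n R by (auto simp: field_simps k_def \<eta>_def)
    have "T w u v" using T T_rot by blast
    have "card {t \<in> V. (w, t) \<notin> shadow} \<le> card {t \<in> V. \<not> T w u t}"
      using finite_V shadowI[of w _ u] T_swap23[of w u] by (intro card_mono) auto
    then have "\<eta> \<le> 243/2000 * n"
      using missing_le'[OF \<open>T w u v\<close>] by (simp add: \<eta>_def missing_def)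
    then show "1757/2000 \<le> 1 - \<eta> / n" using n by (simp add: field_simps)
    \<comment> \<open>Every \<open>y\<close> in \<open>Y\<close> is paired with \<open>w\<close> in
      the shadow. Hence a large \<open>\<eta>\<close>, which weakens the count of common opposite
      pairs, also shrinks \<open>Y\<close>.\<close>
    have "card Y + card {t \<in> V. (w, t) \<notin> shadow} = card (Y \<union> {t \<in> V. (w, t) \<notin> shadow})"
      using finite_V Y_shadow by (intro card_Un_disjoint[symmetric]) (auto simp: Y_def)
    also have "\<dots> \<le> card V" using finite_V by (intro card_mono) (auto simp: Y_def)
    finally show "k / n \<le> 1 - \<eta> / n" using n by (simp add: field_simps k_def \<eta>_def n_def)
  qed
  finally show ?thesis by (simp add: Y_def)
qed

section \<open>Construction of the triple weights\<close>

lemma fractional_decomposition: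
  "\<exists>\<Phi>. (\<forall>u v w. T u v w \<longrightarrow> 0 \<le> \<Phi> u v w) \<and>
    (\<forall>u v w. \<Phi> u v w = \<Phi> v u w \<and> \<Phi> u v w = \<Phi> u w v) \<and>
    (\<forall>u v w. T u v w \<longrightarrow> (\<Sum>x | x \<in> V \<and> T u v x. \<Phi> u v x) = (1::real))"
proof (cases "shadow = {}")
  case True
  then have "\<not> T u v w" for u v w using shadowI by blast
  then show ?thesis by (intro exI[of _ "\<lambda>_ _ _. 0"]) simp
next
  case False
  \<comment> \<open>The mean of the pair degrees \<open>n - missing e\<close>: the constant for
    which the right-hand side of the Laplace equation sums to zero.\<close>
  define c where "c = (\<Sum>e\<in>shadow. n - missing e) / real (card shadow)"
  have card_shadow: "0 < real (card shadow)" using False finite_shadow by (simp add: card_gt_0_iff)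
  have "0 < (\<Sum>e\<in>shadow. n - missing e)"
  proof (rule sum_pos[OF finite_shadow False])
    fix e assume "e \<in> shadow"
    then show "0 < n - missing e" using missing_le n_pos by fastforce
  qed
  then have c: "0 < c" using card_shadow by (simp add: c_def)
  have missing_swap: "missing (u, v) = missing (v, u)" for u v
    using T_swap12 by (simp add: missing_def)
  have "(\<Sum>e\<in>shadow. n - missing e - c) = 0"
    unfolding sum_subtractf[of _ "\<lambda>_. c"] using card_shadow by (simp add: c_def)
  then obtain p where p: "\<forall>e\<in>shadow. laplacian p e = n - missing e - c" and p_swap: "\<And>u v. p (u, v) = p (v, u)"
    using laplacian_solvable_symmetric[of "\<lambda>e. n - missing e - c"] missing_swap by auto
  have lap: "laplacian p e - laplacian p g = missing g - missing e" if "e \<in> shadow" "g \<in> shadow" for e g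
    using p that by simp
  \<comment> \<open>The three summands compare each pair of the triple with its opposite pair in the
    quadruple. Summed over \<open>y\<close>, each is a star sum of at most 1/3, whence
    \<open>\<Phi>\<close> is nonnegative.\<close>
  define F where "F u v w y = (p (u, v) - p (w, y)) + (p (u, w) - p (v, y)) + (p (v, w) - p (u, y))" for u v w y
  define \<Phi> where "\<Phi> u v w = (1 - (\<Sum>y | y \<in> V \<and> K4 u v w y. F u v w y)) / c" for u v w
  have "0 \<le> \<Phi> u v w" if T: "T u v w" for u v w
  proof -
    have eq: "{y \<in> V. K4 u w v y} = {y \<in> V. K4 u v w y}" "{y \<in> V. K4 v w u y} = {y \<in> V. K4 u v w y}"
      using K4_swap12 K4_swap23 by blast+
    have "T u w v" "T v w u" using T T_rot T_swap12 T_swap23 by blast+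
    note * = star_sum_le[OF lap T] star_sum_le[OF lap \<open>T u w v\<close>] star_sum_le[OF lap \<open>T v w u\<close>]
    have "(\<Sum>y | y \<in> V \<and> K4 u v w y. F u v w y) \<le> 1/3 + 1/3 + 1/3"
      unfolding F_def sum.distrib using *[unfolded eq] by (intro add_mono) auto
    then show ?thesis using c by (simp add: \<Phi>_def)
  qed
  moreover have "\<Phi> u v w = \<Phi> v u w \<and> \<Phi> u v w = \<Phi> u w v" for u v w
  proof -
    have "F u v w = F v u w" "F u v w = F u w v"
      using p_swap[of u v] p_swap[of v w] by (auto simp: F_def fun_eq_iff)
    moreover have "K4 u v w = K4 v u w" "K4 u v w = K4 u w v"
      using K4_swap12 K4_swap23 by (auto simp: fun_eq_iff)
    ultimately show ?thesis by (simp add: \<Phi>_def)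
  qed
  moreover have "(\<Sum>x | x \<in> V \<and> T u v x. \<Phi> u v x) = 1" if T: "T u v w" for u v w
  proof -
    have e: "(u, v) \<in> shadow" using shadowI T .
    have opp_eq: "opp (u, v) = (SIGMA x:{x \<in> V. T u v x}. {y \<in> V. K4 u v x y})"
      using T_V' by (auto simp: opp_def K4_def)
    have "(\<Sum>x | x \<in> V \<and> T u v x. \<Sum>y | y \<in> V \<and> K4 u v x y. F u v x y) = (\<Sum>(x, y)\<in>opp (u, v). F u v x y)"
      unfolding opp_eq using finite_V by (simp add: sum.Sigma)
    \<comment> \<open>Apart from \<open>p (u, v) - p h\<close>, the terms change sign when
      \<open>x\<close> and \<open>y\<close> are exchanged, so they cancel over
      \<open>opp (u, v)\<close> and only the Laplacian remains.\<close>
    also have "\<dots> = (\<Sum>h\<in>opp (u, v). (p (u, v) - p h) + ((p (u, fst h) + p (v, fst h)) - (p (u, snd h) + p (v, snd h))))"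
      by (intro sum.cong) (auto simp: F_def)
    also have "\<dots> = laplacian p (u, v)
        + ((\<Sum>h\<in>opp (u, v). p (u, fst h) + p (v, fst h)) - (\<Sum>h\<in>opp (u, v). p (u, snd h) + p (v, snd h)))"
      by (simp only: sum.distrib sum_subtractf laplacian_def)
    also have "(\<Sum>h\<in>opp (u, v). p (u, fst h) + p (v, fst h)) = (\<Sum>h\<in>opp (u, v). p (u, snd h) + p (v, snd h))"
      by (rule sum.reindex_bij_witness[of _ prod.swap prod.swap])
        (auto simp: opp_def intro: K4_swap34[THEN iffD1])
    finally have "(\<Sum>x | x \<in> V \<and> T u v x. \<Sum>y | y \<in> V \<and> K4 u v x y. F u v x y) = n - missing (u, v) - c"
      using p e by simp
    then show ?thesis
      using c by (simp add: \<Phi>_def sum_divide_distrib[symmetric] sum_subtractf card_nbrs)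
  qed
  ultimately show ?thesis by blast
qed

end

section \<open>From ordered triples back to hypergraphs\<close>

lemma card_3_set_iff: "card {u, v, w} = 3 \<longleftrightarrow> u \<noteq> v \<and> u \<noteq> w \<and> v \<noteq> w"
  by (auto simp: card_insert_if)

text \<open>The two transpositions generate all six orders of a triple, so the chosen value does not
  depend on the enumeration.\<close>

lemma symmetric_function_on_triples:
  assumes "\<And>u v w. \<Phi> u v w = \<Phi> v u w \<and> \<Phi> u v w = \<Phi> u w v"
  shows "\<exists>\<phi>. \<forall>u v w. card {u, v, w} = 3 \<longrightarrow> \<phi> {u, v, w} = \<Phi> u v w"
proof -
  define \<phi> where "\<phi> f = (SOME r. \<exists>u v w. f = {u, v, w} \<and> r = \<Phi> u v w)" for f
  have "\<phi> {u, v, w} = \<Phi> u v w" if c: "card {u, v, w} = 3" for u v w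
  proof -
    have "\<exists>r u' v' w'. {u, v, w} = {u', v', w'} \<and> r = \<Phi> u' v' w'" by blast
    then have "\<exists>u' v' w'. {u, v, w} = {u', v', w'} \<and> \<phi> {u, v, w} = \<Phi> u' v' w'"
      unfolding \<phi>_def by (rule someI_ex)
    then obtain u' v' w' where *: "{u, v, w} = {u', v', w'}" "\<phi> {u, v, w} = \<Phi> u' v' w'" by blast
    have "distinct [u, v, w]" "distinct [u', v', w']" using c c[unfolded *(1)] by (simp_all add: card_3_set_iff)
    then have "(u', v', w') \<in> {(u, v, w), (u, w, v), (v, u, w), (v, w, u), (w, u, v), (w, v, u)}"
      using *(1) by (simp add: set_eq_iff) metis
    then show ?thesis using *(2) assms by auto
  qed
  then show ?thesis by blast
qed

lemma perfect_fractional_STS_exists: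
  fixes V :: "'a set"
  assumes H: "three_uniform_hypergraph V E"
    and n: "real (card V) \<ge> 3516"
    and codeg: "\<And>e. e \<in> two_shadow E \<Longrightarrow> real (codegree E e) \<ge> 879/1000 * (real (card V) - 2)"
  shows "\<exists>\<phi>. perfect_fractional_STS E \<phi>"
proof -
  define T where "T u v w \<longleftrightarrow> {u, v, w} \<in> E" for u v w
  have E: "f \<subseteq> V" "card f = 3" if "f \<in> E" for f using H that by (auto simp: three_uniform_hypergraph_def)
  have fin: "finite V" using H by (simp add: three_uniform_hypergraph_def)
  have shadow: "{u, v} \<in> two_shadow E" if "T u v w" for u v w
    using E(2)[of "{u, v, w}"] that by (auto simp: two_shadow_def T_def card_3_set_iff)
  have bij: "bij_betw (\<lambda>x. {u, v, x}) {x \<in> V. T u v x} {f \<in> E. {u, v} \<subseteq> f}" if "u \<noteq> v" for u v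
  proof (rule bij_betwI')
    fix x y assume "x \<in> {x \<in> V. T u v x}" "y \<in> {x \<in> V. T u v x}"
    then have "card {u, v, x} = 3" "card {u, v, y} = 3" using E(2) by (auto simp: T_def)
    then show "({u, v, x} = {u, v, y}) = (x = y)" by (auto simp: card_3_set_iff)
  next
    fix x assume "x \<in> {x \<in> V. T u v x}"
    then show "{u, v, x} \<in> {f \<in> E. {u, v} \<subseteq> f}" by (simp add: T_def)
  next
    fix f assume f: "f \<in> {f \<in> E. {u, v} \<subseteq> f}"
    then have "card (f - {u, v}) = 1"
      using E(2)[of f] that by (subst card_Diff_subset) auto
    then obtain x where "f - {u, v} = {x}" by (auto simp: card_1_singleton_iff)
    then have "f = {u, v, x}" using f by auto
    then show "\<exists>x\<in>{x \<in> V. T u v x}. f = {u, v, x}" using f E(1)[of f] by (auto simp: T_def)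
  qed
  interpret dense_triple_system V T
  proof
    fix x y z
    show "finite V" by (rule fin)
    show "x \<in> V" if "T x y z" using E(1) that by (auto simp: T_def)
    show "T x y z = T y x z" "T x y z = T x z y" by (simp_all add: T_def insert_commute)
    assume T: "T x y z"
    then have "x \<noteq> y" using E(2)[of "{x, y, z}"] by (auto simp: T_def card_3_set_iff)
    then have "card {t \<in> V. T x y t} = codegree E {x, y}"
      using bij_betw_same_card[OF bij] by (simp add: codegree_def)
    moreover have "card V = card {t \<in> V. T x y t} + card {t \<in> V. \<not> T x y t}"
      using fin by (subst card_Un_disjoint[symmetric]) (auto intro: arg_cong[of _ _ card])
    \<comment> \<open>Here 3516 is sharp: at most 121/1000 n + 1.758 vertices are missing, and 1.758
      = 3516/2000.\<close>
    ultimately show "real (card {t \<in> V. \<not> T x y t}) \<le> 243/2000 * real (card V)"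
      using codeg[OF shadow[OF T]] n by simp
  qed
  obtain \<Phi> where nonneg: "\<And>u v w. T u v w \<Longrightarrow> 0 \<le> \<Phi> u v w"
    and sym: "\<And>u v w. \<Phi> u v w = \<Phi> v u w \<and> \<Phi> u v w = \<Phi> u w v"
    and one: "\<And>u v w. T u v w \<Longrightarrow> (\<Sum>x | x \<in> V \<and> T u v x. \<Phi> u v x) = (1::real)"
    using fractional_decomposition by blast
  obtain \<phi> where \<phi>: "\<And>u v w. card {u, v, w} = 3 \<Longrightarrow> \<phi> {u, v, w} = \<Phi> u v w"
    using symmetric_function_on_triples[of \<Phi>] sym by blast
  have \<phi>_T: "\<phi> {u, v, w} = \<Phi> u v w" if "T u v w" for u v w
    using \<phi> E(2) that by (simp add: T_def)
  have triple: "\<exists>u v w. f = {u, v, w} \<and> T u v w" if "f \<in> E" for f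
    using E(2)[OF that] that unfolding card_3_iff T_def by blast
  have pos: "0 \<le> \<phi> f" if "f \<in> E" for f
    using triple[OF that] nonneg \<phi>_T by auto
  have sum1: "(\<Sum>f\<in>{f \<in> E. e \<subseteq> f}. \<phi> f) = 1" if e_shadow: "e \<in> two_shadow E" for e
  proof -
    obtain u v where e: "e = {u, v}" "u \<noteq> v" using e_shadow card_2_iff[of e] unfolding two_shadow_def by blast
    obtain f where "f \<in> {f \<in> E. {u, v} \<subseteq> f}" using e_shadow e by (auto simp: two_shadow_def)
    then have "f \<in> (\<lambda>x. {u, v, x}) ` {x \<in> V. T u v x}"
      using bij_betw_imp_surj_on[OF bij[OF e(2)]] by simp
    then obtain w where w: "T u v w" by blast
    have "(\<Sum>f\<in>{f \<in> E. e \<subseteq> f}. \<phi> f) = (\<Sum>x | x \<in> V \<and> T u v x. \<phi> {u, v, x})"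
      unfolding e(1) by (rule sum.reindex_bij_betw[OF bij[OF e(2)], symmetric])
    also have "\<dots> = (\<Sum>x | x \<in> V \<and> T u v x. \<Phi> u v x)" by (intro sum.cong) (auto simp: \<phi>_T)
    finally show ?thesis using one[OF w] by simp
  qed
  \<comment> \<open>A weight is one of the nonnegative summands of a pair sum equal to 1.\<close>
  have "\<phi> f \<le> 1" if f_E: "f \<in> E" for f
  proof -
    obtain u v w where f: "f = {u, v, w}" "T u v w" using triple[OF f_E] by blast
    have "finite E" using finite_subset[of E "Pow V"] E(1) fin by auto
    then have "\<phi> f \<le> (\<Sum>f\<in>{f \<in> E. {u, v} \<subseteq> f}. \<phi> f)"
      using f_E f pos by (intro member_le_sum) auto
    then show ?thesis using sum1[OF shadow[OF f(2)]] by simp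
  qed
  then show ?thesis using pos sum1 by (auto simp: perfect_fractional_STS_def)
qed

section \<open>The bound on the threshold\<close>

theorem theorem1p8:
  fixes \<epsilon> :: real
  assumes "0 \<le> \<epsilon>" and "\<epsilon> < 1"
  shows "\<delta>\<^sub>f \<epsilon> \<le> (3 + sqrt 57) / 12 \<and> (3 + sqrt 57) / 12 < (0.88 :: real)"
proof
  have "forces_fractional_STS \<epsilon> (879/1000)"
    unfolding forces_fractional_STS_def
    by (intro exI[of _ 3516] allI impI perfect_fractional_STS_exists) auto
  then have "\<delta>\<^sub>f \<epsilon> \<le> 879/1000"
    unfolding \<delta>\<^sub>f_def by (intro cInf_lower bdd_belowI[of _ 0]) auto
  \<comment> \<open>The comparison needs only sqrt 57 >= 12 * 0.879 - 3 = 7.548; in the second part,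
    7.56 is exactly 12 * 0.88 - 3.\<close>
  also have "(7.549 :: real) \<le> sqrt 57" by (rule real_le_rsqrt) (simp add: power2_eq_square)
  then have "879/1000 \<le> (3 + sqrt 57) / 12" by simp
  finally show "\<delta>\<^sub>f \<epsilon> \<le> (3 + sqrt 57) / 12" .
  have "sqrt 57 < (7.56 :: real)" by (rule real_less_lsqrt) (simp_all add: power2_eq_square)
  then show "(3 + sqrt 57) / 12 < (0.88 :: real)" by simp
qed

end
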